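(* Let $(P,\rho,\bar\zeta)$ be a quasi-graded poset with minimal element $\hat0$ and maximal element $\hat1$. Assume that $P$ has a zipper $x,y,z$ with $z\neq\hat0$, and let $(Q,\rho_Q,\bar\zeta_Q)$ be the zipped quasi-graded poset, with new element $w$. Then the $\mathbf{ab}$-indexes of $Q$ and of the interval $[\hat0,w]$ of $Q$ are given by $$\Psi(Q)=\Psi(P)-\Psi([\hat0,z])\cdot\mathbf d\cdot\Psi([x,\hat1]),$$ $$\Psi([\hat0,w])=\Psi([\hat0,x])+\Psi([\hat0,y])-\Psi([\hat0,z])\cdot\mathbf c,$$ where $\mathbf c=\mathbf a+\mathbf b$, $\mathbf d=\mathbf a\mathbf b+\mathbf b\mathbf a$, and all intervals on the right-hand sides are taken in $P$.
   Context: A quasi-graded poset $(P,\rho,\bar\zeta)$ consists of a finite poset $P$, a function $\rho:P\to\mathbb N$ with $x<y\Rightarrow\rho(x)<\rho(y)$, and a complex-valued function $\bar\zeta$ in the incidence algebra of $P$ with $\bar\zeta(x,x)=1$ for all $x$; set $\bar\zeta(u,v)=0$ if $u\not\le v$. Write $\rho(x,y)=\rho(y)-\rho(x)$. Intervals are quasi-graded posets by restriction. For a quasi-graded poset with minimal element $\hat0$ and maximal element $\hat1$, $\hat0<\hat1$, the $\mathbf{ab}$-index is the polynomial in non-commuting variables $\mathbf a,\mathbf b$ $$\Psi(P)=\sum_{c}\bar\zeta(x_0,x_1)\cdots\bar\zeta(x_{k-1},x_k)\cdot(\mathbf a-\mathbf b)^{\rho(x_0,x_1)-1}\,\mathbf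 b\,(\mathbf a-\mathbf b)^{\rho(x_1,x_2)-1}\,\mathbf b\cdots\mathbf b\,(\mathbf a-\mathbf b)^{\rho(x_{k-1},x_k)-1},$$ the sum over all chains $c=\{\hat0=x_0<x_1<\cdots<x_k=\hat1\}$, $k\ge1$. A zipper in $(P,\rho,\bar\zeta)$ consists of three distinct elements $x,y,z$ such that (i) $\rho(x)=\rho(y)=\rho(z)+1$; (ii) $z$ is covered by $x$ and $y$ and by no other element; (iii) for all $v>z$ with $\rho(v)>\rho(x)$, $\bar\zeta(x,v)=\bar\zeta(y,v)=\bar\zeta(z,v)$; (iv) $\bar\zeta(z,x)=\bar\zeta(z,y)=1$. The zipped quasi-graded poset is $Q=(P\setminus\{x,y,z\})\cup\{w\}$ with $w$ a new element. $Q$ inherits the order of $P$ together with the relations $u<_Qw$ if $u<_Px$ or $u<_Py$, and $w<_Qv$ if $x<_Pv$ or $y<_Pv$ (and relations implied by transitivity). $\rho_Q$ is inherited from $P$ with $\rho_Q(w)=\rho(x)$. $\bar\zeta_Q$ is inherited from $\bar\zeta$ on pairs not involving $w$, and $\bar\zeta_Q(w,v)=\bar\zeta(x,v)$, $\bar\zeta_Q(u,w)=\bar\zeta(u,x)+\bar\zeta(u,y)-\bar\zeta(u,z)$, $\bar\zeta_Q(w,w)=1$. *)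

theory Defs
  imports Complex_Main "HOL-Library.Poly_Mapping"
begin

section \<open>Polynomials in two non-commuting variables\<close>

text \<open>
  Finitely supported functions on the free monoid on two letters, with the convolution product of
  \<^theory>\<open>HOL-Library.Poly_Mapping\<close>, form the free associative algebra. That theory expects the
  monoid in additive notation, so concatenation of words is written as addition.
\<close>

datatype ab_letter = LetterA | LetterB

datatype ab_word = Word (letters: "ab_letter list")

instantiation ab_word :: monoid_add
begin

definition zero_ab_word :: ab_word where
  "0 = Word []"

definition plus_ab_word :: "ab_word \<Rightarrow> ab_word \<Rightarrow> ab_word" where
  "u + v = Word (letters u @ letters v)"

instance
  by standard (simp_all add: zero_ab_word_def plus_ab_word_def)

end

type_synonym ab_poly = "ab_word \<Rightarrow>\<^sub>0 complex"

definition ab_const :: "complex \<Rightarrow> ab_poly" where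
  "ab_const k = Poly_Mapping.single 0 k"

definition a_var :: ab_poly ("\<^bold>a") where
  "\<^bold>a = Poly_Mapping.single (Word [LetterA]) 1"

definition b_var :: ab_poly ("\<^bold>b") where
  "\<^bold>b = Poly_Mapping.single (Word [LetterB]) 1"

definition c_poly :: ab_poly ("\<^bold>c") where
  "\<^bold>c = \<^bold>a + \<^bold>b"

definition d_poly :: ab_poly ("\<^bold>d") where
  "\<^bold>d = \<^bold>a * \<^bold>b + \<^bold>b * \<^bold>a"


section \<open>Quasi-graded posets\<close>

record 'p qg_poset =
  elems :: "'p set"
  ord :: "('p \<times> 'p) set"
  rank :: "'p \<Rightarrow> nat"
  zeta :: "'p \<Rightarrow> 'p \<Rightarrow> complex"

definition lt :: "'p qg_poset \<Rightarrow> 'p \<Rightarrow> 'p \<Rightarrow> bool" where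
  "lt P u v \<longleftrightarrow> (u, v) \<in> ord P \<and> u \<noteq> v"

definition quasi_graded :: "'p qg_poset \<Rightarrow> bool" where
  "quasi_graded P \<longleftrightarrow>
     finite (elems P) \<and>
     partial_order_on (elems P) (ord P) \<and>
     (\<forall>u\<in>elems P. \<forall>v\<in>elems P. lt P u v \<longrightarrow> rank P u < rank P v) \<and>
     (\<forall>u\<in>elems P. zeta P u u = 1) \<and>
     (\<forall>u\<in>elems P. \<forall>v\<in>elems P. (u, v) \<notin> ord P \<longrightarrow> zeta P u v = 0)"

definition is_least :: "'p qg_poset \<Rightarrow> 'p \<Rightarrow> bool" where
  "is_least P m \<longleftrightarrow> m \<in> elems P \<and> (\<forall>u\<in>elems P. (m, u) \<in> ord P)"

definition is_greatest :: "'p qg_poset \<Rightarrow> 'p \<Rightarrow> bool" where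
  "is_greatest P m \<longleftrightarrow> m \<in> elems P \<and> (\<forall>u\<in>elems P. (u, m) \<in> ord P)"

definition covers :: "'p qg_poset \<Rightarrow> 'p \<Rightarrow> 'p \<Rightarrow> bool" where
  "covers P v u \<longleftrightarrow> lt P u v \<and> (\<nexists>t. lt P u t \<and> lt P t v)"

definition interval :: "'p qg_poset \<Rightarrow> 'p \<Rightarrow> 'p \<Rightarrow> 'p qg_poset" where
  "interval P u v =
     (let I = {t \<in> elems P. (u, t) \<in> ord P \<and> (t, v) \<in> ord P}
      in P\<lparr>elems := I, ord := Restr (ord P) I\<rparr>)"


section \<open>The ab-index\<close>

text \<open>
  Chains are listed in increasing order; length at least 2 means at least one step.
\<close>

definition bounding_chains :: "'p qg_poset \<Rightarrow> 'p list set" where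
  "bounding_chains P =
     {xs. length xs \<ge> 2 \<and> set xs \<subseteq> elems P \<and> sorted_wrt (lt P) xs \<and>
          is_least P (hd xs) \<and> is_greatest P (last xs)}"

definition chain_zeta :: "'p qg_poset \<Rightarrow> 'p list \<Rightarrow> complex" where
  "chain_zeta P xs = (\<Prod>i<length xs - 1. zeta P (xs ! i) (xs ! Suc i))"

text \<open>
  Natural subtraction in the exponents is harmless since the rank strictly increases along a chain.
  The last equation covers lists of length less than 2, which are not summed over.
\<close>

fun chain_word :: "'p qg_poset \<Rightarrow> 'p list \<Rightarrow> ab_poly" where
  "chain_word P [u, v] = (\<^bold>a - \<^bold>b) ^ (rank P v - rank P u - 1)"
| "chain_word P (u # v # t # xs) =
     (\<^bold>a - \<^bold>b) ^ (rank P v - rank P u - 1) * \<^bold>b * chain_word P (v # t # xs)"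
| "chain_word P _ = 0"

definition ab_index :: "'p qg_poset \<Rightarrow> ab_poly" ("\<Psi>") where
  "\<Psi> P = (\<Sum>xs\<in>bounding_chains P. ab_const (chain_zeta P xs) * chain_word P xs)"


section \<open>Zippers\<close>

definition zipper :: "'p qg_poset \<Rightarrow> 'p \<Rightarrow> 'p \<Rightarrow> 'p \<Rightarrow> bool" where
  "zipper P x y z \<longleftrightarrow>
     x \<in> elems P \<and> y \<in> elems P \<and> z \<in> elems P \<and> x \<noteq> y \<and> x \<noteq> z \<and> y \<noteq> z \<and>
     rank P x = rank P y \<and> rank P y = rank P z + 1 \<and>
     {t \<in> elems P. covers P t z} = {x, y} \<and>
     (\<forall>v\<in>elems P. lt P z v \<and> rank P v > rank P x \<longrightarrow>
        zeta P x v = zeta P y v \<and> zeta P y v = zeta P z v) \<and>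
     zeta P z x = 1 \<and> zeta P z y = 1"

definition zipped :: "'p qg_poset \<Rightarrow> 'p \<Rightarrow> 'p \<Rightarrow> 'p \<Rightarrow> 'p \<Rightarrow> 'p qg_poset" where
  "zipped P x y z w =
     (let S = elems P - {x, y, z} in
      \<lparr>elems = insert w S,
       ord = (Restr (ord P) S \<union> {(w, w)}
              \<union> {(u, w) | u. u \<in> S \<and> (lt P u x \<or> lt P u y)}
              \<union> {(w, v) | v. v \<in> S \<and> (lt P x v \<or> lt P y v)})\<^sup>+,
       rank = (rank P)(w := rank P x),
       zeta = (\<lambda>u v.
         if u = w \<and> v = w then 1
         else if u = w then zeta P x v
         else if v = w then zeta P u x + zeta P u y - zeta P u z
         else zeta P u v)\<rparr>)"


section \<open>The constructions stay within quasi-graded posets\<close>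

lemma finite_bounding_chains:
  assumes "quasi_graded P"
  shows "finite (bounding_chains P)"
proof -
  have *: "distinct xs" if "sorted_wrt (lt P) xs" and sub: "set xs \<subseteq> elems P" for xs
  proof -
    have "sorted_wrt (\<lambda>u v. rank P u < rank P v) xs"
      by (rule sorted_wrt_mono_rel[OF _ that(1)])
        (use sub assms in \<open>simp add: quasi_graded_def subset_iff\<close>)
    then have "sorted_wrt (<) (map (rank P) xs)"
      by (simp add: sorted_wrt_map)
    then show ?thesis
      using distinct_map strict_sorted_iff by blast
  qed
  have "bounding_chains P \<subseteq> {xs. set xs \<subseteq> elems P \<and> length xs \<le> card (elems P)}"
  proof (intro subsetI CollectI)
    fix xs assume xs: "xs \<in> bounding_chains P"
    then have "card (set xs) = length xs" and "set xs \<subseteq> elems P"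
      using * by (auto simp: bounding_chains_def distinct_card)
    moreover from this have "card (set xs) \<le> card (elems P)"
      using assms by (intro card_mono) (simp_all add: quasi_graded_def)
    ultimately show "set xs \<subseteq> elems P \<and> length xs \<le> card (elems P)"
      by simp
  qed
  then show ?thesis
    using assms finite_lists_length_le finite_subset unfolding quasi_graded_def by blast
qed

lemma quasi_graded_interval:
  assumes "quasi_graded P"
  shows "quasi_graded (interval P u v)"
proof -
  define I where "I = {t \<in> elems P. (u, t) \<in> ord P \<and> (t, v) \<in> ord P}"
  have sub: "I \<subseteq> elems P"
    by (auto simp: I_def)
  have [simp]: "interval P u v = P\<lparr>elems := I, ord := Restr (ord P) I\<rparr>"
    by (simp add: interval_def I_def Let_def)
  have po: "partial_order_on (elems P) (ord P)"
    using assms by (simp add: quasi_graded_def)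
  then have "refl_on I (Restr (ord P) I)"
    using sub by (auto simp: partial_order_on_def preorder_on_def refl_on_def)
  moreover have "trans (Restr (ord P) I)" "antisym (Restr (ord P) I)"
    using po by (auto simp: partial_order_on_def preorder_on_def trans_Restr
        intro: antisym_subset[of "Restr (ord P) I" "ord P"])
  ultimately have "partial_order_on I (Restr (ord P) I)"
    by (auto simp: partial_order_on_def preorder_on_def)
  moreover have "finite I"
    using sub assms finite_subset by (auto simp: quasi_graded_def)
  moreover have "rank P s < rank P t" if "s \<in> I" "t \<in> I" "(s, t) \<in> ord P" "s \<noteq> t" for s t
    using that sub assms by (simp add: quasi_graded_def lt_def subset_iff)
  moreover have "zeta P t t = 1" if "t \<in> I" for t
    using that sub assms by (simp add: quasi_graded_def subset_iff)
  moreover have "zeta P s t = 0" if "s \<in> I" "t \<in> I" "(s, t) \<notin> ord P" for s t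
    using that sub assms by (simp add: quasi_graded_def subset_iff)
  ultimately show ?thesis
    by (simp add: quasi_graded_def lt_def)
qed

lemma quasi_graded_zipped:
  assumes P: "quasi_graded P" and z: "zipper P x y z" and w: "w \<notin> elems P"
  shows "quasi_graded (zipped P x y z w)"
proof -
  let ?Q = "zipped P x y z w" and ?S = "elems P - {x, y, z}"
  define B where "B = Restr (ord P) ?S \<union> {(w, w)}
              \<union> {(u, w) | u. u \<in> ?S \<and> (lt P u x \<or> lt P u y)}
              \<union> {(w, v) | v. v \<in> ?S \<and> (lt P x v \<or> lt P y v)}"
  have elemsQ: "elems ?Q = insert w ?S" and ordQ: "ord ?Q = B\<^sup>+"
    and rankQ: "rank ?Q = (rank P)(w := rank P x)"
    and zetaQ: "zeta ?Q = (\<lambda>u v. if u = w \<and> v = w then 1 else if u = w then zeta P x v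
         else if v = w then zeta P u x + zeta P u y - zeta P u z else zeta P u v)"
    by (simp_all add: zipped_def B_def Let_def)
  have po: "partial_order_on (elems P) (ord P)" and fin: "finite (elems P)"
    and rk: "\<And>u v. u \<in> elems P \<Longrightarrow> v \<in> elems P \<Longrightarrow> lt P u v \<Longrightarrow> rank P u < rank P v"
    and z1: "\<And>u. u \<in> elems P \<Longrightarrow> zeta P u u = 1"
    and z0: "\<And>u v. u \<in> elems P \<Longrightarrow> v \<in> elems P \<Longrightarrow> (u, v) \<notin> ord P \<Longrightarrow> zeta P u v = 0"
    using P by (auto simp: quasi_graded_def)
  have xyz: "x \<in> elems P" "y \<in> elems P" "z \<in> elems P" "rank P x = rank P y"
    and zx: "(z, x) \<in> ord P"
    using z by (auto simp: zipper_def covers_def lt_def)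
  have trP: "trans (ord P)"
    using po by (simp add: partial_order_on_def preorder_on_def)
  have B_mono: "u = v \<or> rank ?Q u < rank ?Q v" if uv: "(u, v) \<in> B" for u v
  proof -
    consider "u \<in> ?S" "v \<in> ?S" "(u, v) \<in> ord P" | "u = v"
      | "u \<in> ?S" "v = w" "lt P u x \<or> lt P u y" | "u = w" "v \<in> ?S" "lt P x v \<or> lt P y v"
      using uv unfolding B_def by blast
    then show ?thesis
    proof cases
      case 1
      then show ?thesis using rk[of u v] w by (auto simp: rankQ lt_def)
    next
      case 2
      then show ?thesis by simp
    next
      case 3
      then show ?thesis using rk[of u x] rk[of u y] w xyz by (auto simp: rankQ)
    next
      case 4
      then show ?thesis using rk[of x v] rk[of y v] w xyz by (auto simp: rankQ)
    qed
  qed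
  have mono: "u = v \<or> rank ?Q u < rank ?Q v" if "(u, v) \<in> B\<^sup>+" for u v
    using that
  proof (induction rule: trancl_induct)
    case (base t)
    then show ?case using B_mono by blast
  next
    case (step s t)
    then show ?case using B_mono[of s t] by auto
  qed
  have "B \<subseteq> insert w ?S \<times> insert w ?S"
    by (auto simp: B_def)
  then have "B\<^sup>+ \<subseteq> insert w ?S \<times> insert w ?S"
    by (rule trancl_subset_Sigma)
  moreover have "refl_on (insert w ?S) (B\<^sup>+)"
  proof (rule refl_onI)
    fix u assume "u \<in> insert w ?S"
    then have "(u, u) \<in> B"
      using po by (auto simp: B_def partial_order_on_def preorder_on_def refl_on_def)
    then show "(u, u) \<in> B\<^sup>+"
      by blast
  qed
  moreover have "antisym (B\<^sup>+)"
    by (rule antisymI) (metis mono less_asym)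
  ultimately have poQ: "partial_order_on (elems ?Q) (ord ?Q)"
    by (simp add: elemsQ ordQ partial_order_on_def preorder_on_def)
  have zetaQ0: "zeta ?Q u v = 0"
    if uv: "u \<in> insert w ?S" "v \<in> insert w ?S" "(u, v) \<notin> B\<^sup>+" for u v
  proof -
    have nB: "(u, v) \<notin> B"
      using uv(3) by blast
    consider "u = w" "v = w" | "u = w" "v \<noteq> w" | "u \<noteq> w" "v = w" | "u \<noteq> w" "v \<noteq> w"
      by blast
    then show ?thesis
    proof cases
      case 1
      then show ?thesis using nB by (simp add: B_def)
    next
      case 2
      then have "v \<in> ?S" "(x, v) \<notin> ord P"
        using uv nB by (auto simp: B_def lt_def)
      then show ?thesis using 2 z0 xyz by (simp add: zetaQ)
    next
      case 3
      then have u: "u \<in> ?S" and ux: "(u, x) \<notin> ord P" and uy: "(u, y) \<notin> ord P"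
        using uv nB by (auto simp: B_def lt_def)
      then have "(u, z) \<notin> ord P"
        using zx trP by (meson transD)
      then show ?thesis using 3 u ux uy z0 xyz by (simp add: zetaQ)
    next
      case 4
      then have "u \<in> ?S" "v \<in> ?S" "(u, v) \<notin> ord P"
        using uv nB by (auto simp: B_def)
      then show ?thesis using 4 z0 by (simp add: zetaQ)
    qed
  qed
  show ?thesis
    unfolding quasi_graded_def
  proof (intro conjI ballI impI)
    show "finite (elems ?Q)" using fin by (simp add: elemsQ)
    show "partial_order_on (elems ?Q) (ord ?Q)" by (rule poQ)
    show "rank ?Q u < rank ?Q v" if "lt ?Q u v" for u v
      using that mono by (auto simp: lt_def ordQ)
    show "zeta ?Q u u = 1" if "u \<in> elems ?Q" for u
      using that z1 by (auto simp: zetaQ elemsQ)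
    show "zeta ?Q u v = 0" if "u \<in> elems ?Q" "v \<in> elems ?Q" "(u, v) \<notin> ord ?Q" for u v
      using that zetaQ0 by (simp add: elemsQ ordQ)
  qed
qed

end

theory Submission
  imports Defs
begin

text \<open>
  Splitting off the first step of a chain gives
  \<open>\<Psi>[u,v] = K(u,v) + (\<Sum>t. K(u,t) \<^bold>b \<Psi>[t,v])\<close> with \<open>K(u,v) = \<zeta>(u,v) (\<^bold>a - \<^bold>b)\<^bsup>\<rho>(u,v)-1\<^esup>\<close>.
  The zipper conditions say that the rows \<open>K(x,-)\<close> and \<open>K(y,-)\<close> agree and that
  \<open>K(z,-) = (\<^bold>a - \<^bold>b) K(x,-)\<close> above the rank of \<open>x\<close>, whence
  \<open>\<Psi>[z,p1] = (\<^bold>a - \<^bold>b) \<Psi>[x,p1] + 2 \<^bold>b \<Psi>[x,p1] = \<^bold>c \<Psi>[x,p1]\<close>; moreover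
  \<open>K\<^sub>Q(u,w) = K(u,x) + K(u,y) - K(u,z) (\<^bold>a - \<^bold>b)\<close>. Comparing the recursions of \<open>P\<close> and \<open>Q\<close> by
  downward induction on the rank of \<open>u\<close>, the discrepancy is \<open>\<Psi>[u,z]\<close> times
  \<open>\<^bold>b \<^bold>c + (\<^bold>a - \<^bold>b) \<^bold>b = \<^bold>d\<close> in the first identity and
  \<open>\<^bold>c - 2 \<^bold>b = \<^bold>a - \<^bold>b\<close> accounts for the second.
\<close>

section \<open>Central scalars, one-step kernels and weights of chains\<close>

lemma ab_const_0 [simp]: "ab_const 0 = 0"
  by (simp add: ab_const_def)

lemma ab_const_1 [simp]: "ab_const 1 = 1"
  by (simp add: ab_const_def)

lemma ab_const_mult: "ab_const (k * l) = ab_const k * ab_const l"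
  by (simp add: ab_const_def mult_single)

lemma ab_const_add: "ab_const (k + l) = ab_const k + ab_const l"
  by (simp add: ab_const_def single_add)

lemma ab_const_diff: "ab_const (k - l) = ab_const k - ab_const l"
  by (simp add: ab_const_def single_diff)

text \<open>Monomials are added one at a time. The scalar sits on the empty word, which is neutral
  on both sides, so it commutes with each monomial.\<close>

lemma ab_const_commute: "ab_const k * p = p * ab_const k"
proof (induction p rule: update_induct)
  case (update p m c)
  have "Poly_Mapping.update m c p = p + Poly_Mapping.single m c"
    using update.hyps(1)
    by (intro poly_mapping_eqI) (auto simp: lookup_update lookup_add lookup_single in_keys_iff)
  then show ?case
    using update.IH by (simp add: distrib_left distrib_right ab_const_def mult_single mult.commute)
qed simp

text \<open>The cut-off is by rank, not by order, since \<open>zeta\<close> already vanishes on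
  pairs outside the order. Kernels before and after zipping can thus be compared without unfolding
  the transitive closure that defines the zipped order.\<close>

definition step :: "'p qg_poset \<Rightarrow> 'p \<Rightarrow> 'p \<Rightarrow> ab_poly" where
  "step P u v = (if rank P u < rank P v
     then ab_const (zeta P u v) * (\<^bold>a - \<^bold>b) ^ (rank P v - rank P u - 1) else 0)"

definition weight :: "'p qg_poset \<Rightarrow> 'p list \<Rightarrow> ab_poly" where
  "weight P xs = ab_const (chain_zeta P xs) * chain_word P xs"

definition chains :: "'p qg_poset \<Rightarrow> 'p \<Rightarrow> 'p \<Rightarrow> 'p list set" where
  "chains P u v = {xs. length xs \<ge> 2 \<and> set xs \<subseteq> elems P \<and> sorted_wrt (lt P) xs \<and>
     hd xs = u \<and> last xs = v}"

lemma step_rank_ge [simp]: "rank P v \<le> rank P u \<Longrightarrow> step P u v = 0"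
  by (simp add: step_def)

lemma chain_zeta_Cons_Cons:
  "chain_zeta P (u # v # xs) = zeta P u v * chain_zeta P (v # xs)"
  by (simp add: chain_zeta_def lessThan_Suc_eq_insert_0 prod.reindex zero_notin_Suc_image)

lemma weight_pair:
  assumes "rank P u < rank P v"
  shows "weight P [u, v] = step P u v"
  using assms by (simp add: weight_def step_def chain_zeta_def)

text \<open>A tail with a single entry is excluded because the last step of a chain is followed by
  no \<open>b\<close>; that case is \<open>weight_pair\<close>.\<close>

lemma weight_Cons:
  assumes "rank P u < rank P (hd xs)" and "length xs \<ge> 2"
  shows "weight P (u # xs) = step P u (hd xs) * \<^bold>b * weight P xs"
proof -
  obtain v t ys where xs: "xs = v # t # ys"
    using assms(2) by (cases xs; cases "tl xs") auto
  \<comment> \<open>The scalar of the tail has to move past the kernel of the first step and the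
    letter \<open>b\<close>.\<close>
  have "ab_const k * (p * \<^bold>b * q) = p * \<^bold>b * (ab_const k * q)" for k p q
    by (metis ab_const_commute mult.assoc)
  then show ?thesis
    using assms(1) unfolding xs
    by (simp add: weight_def step_def chain_zeta_Cons_Cons[of P u] ab_const_mult mult.assoc)
qed

section \<open>Chains with prescribed ends and ab-indexes of intervals\<close>

lemma quasi_gradedD:
  assumes "quasi_graded P"
  shows "finite (elems P)" and "trans (ord P)" and "antisym (ord P)"
    and "u \<in> elems P \<Longrightarrow> (u, u) \<in> ord P"
    and "lt P u v \<Longrightarrow> rank P u < rank P v"
    and "u \<in> elems P \<Longrightarrow> v \<in> elems P \<Longrightarrow> (u, v) \<notin> ord P \<Longrightarrow> zeta P u v = 0"
  using assms
  by (auto simp: quasi_graded_def partial_order_on_def preorder_on_def refl_on_def lt_def)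

lemma transp_lt: "quasi_graded P \<Longrightarrow> transp (lt P)"
  by (rule transpI) (metis lt_def quasi_gradedD(2,3) transD antisymD)

text \<open>Equal elements have equal rank; for all other such pairs \<open>zeta\<close> is zero.
  Sums over the elements above \<open>u\<close> may therefore range over all elements.\<close>

lemma step_not_lt:
  assumes "quasi_graded P" and "u \<in> elems P" and "v \<in> elems P" and "\<not> lt P u v"
  shows "step P u v = 0"
  using assms quasi_gradedD(6)[OF assms(1-3)] by (auto simp: step_def lt_def)

lemma chains_lt:
  assumes "quasi_graded P" and "xs \<in> chains P u v"
  shows "lt P u v"
proof -
  obtain a b ys where "xs = a # b # ys"
    using assms(2) by (cases xs; cases "tl xs") (auto simp: chains_def)
  then show ?thesis
    using assms(2) last_in_set[of "b # ys"] by (auto simp: chains_def)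
qed

lemma chains_between:
  assumes P: "quasi_graded P" and xs: "xs \<in> chains P u v" and "s \<in> set xs"
  shows "(u, s) \<in> ord P \<and> (s, v) \<in> ord P"
proof -
  obtain ys zs where s: "xs = ys @ s # zs"
    using assms(3) split_list by metis
  have "(u, s) \<in> ord P"
  proof (cases ys)
    case Nil
    then show ?thesis
      using xs quasi_gradedD(4)[OF P] by (auto simp: s chains_def)
  qed (use xs in \<open>auto simp: s chains_def lt_def\<close>)
  moreover have "(s, v) \<in> ord P"
  proof (cases zs)
    case Nil
    then show ?thesis
      using xs quasi_gradedD(4)[OF P] by (auto simp: s chains_def)
  next
    case (Cons b bs)
    then have "v \<in> set zs"
      using xs by (auto simp: s chains_def)
    then show ?thesis
      using xs by (auto simp: s chains_def lt_def sorted_wrt_append)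
  qed
  ultimately show ?thesis ..
qed

lemma bounding_chains_eq:
  assumes P: "quasi_graded P" and "is_least P u" and "is_greatest P v"
  shows "bounding_chains P = chains P u v"
proof -
  have "is_least P s \<longleftrightarrow> s = u" "is_greatest P s \<longleftrightarrow> s = v" for s
    using assms(2,3) antisymD[OF quasi_gradedD(3)[OF P]]
    by (auto simp: is_least_def is_greatest_def)
  then show ?thesis
    by (auto simp: bounding_chains_def chains_def)
qed

lemma interval_simps [simp]:
  "elems (interval P u v) = {t \<in> elems P. (u, t) \<in> ord P \<and> (t, v) \<in> ord P}"
  "rank (interval P u v) = rank P"
  "zeta (interval P u v) = zeta P"
  by (simp_all add: interval_def Let_def)

lemma lt_interval:
  "lt (interval P u v) s t \<longleftrightarrow>
     lt P s t \<and> s \<in> elems (interval P u v) \<and> t \<in> elems (interval P u v)"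
  by (auto simp: interval_def Let_def lt_def)

lemma weight_interval: "weight (interval P u v) xs = weight P xs"
proof -
  have "chain_word (interval P u v) xs = chain_word P xs"
    by (induction P xs rule: chain_word.induct) simp_all
  then show ?thesis
    by (simp add: weight_def chain_zeta_def)
qed

text \<open>Every member of a chain lies between its ends, so passing to the interval loses no
  chain. If \<open>u\<close> is not below \<open>v\<close>, both sides are empty.\<close>

lemma bounding_chains_interval:
  assumes P: "quasi_graded P" and "u \<in> elems P" and "v \<in> elems P"
  shows "bounding_chains (interval P u v) = chains P u v"
proof (cases "(u, v) \<in> ord P")
  case True
  let ?I = "interval P u v"
  have l: "is_least ?I u" and g: "is_greatest ?I v"
    using True assms quasi_gradedD(4)[OF P]
    by (auto simp: is_least_def is_greatest_def interval_def Let_def)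
  have "chains ?I u v = chains P u v"
  proof (intro set_eqI iffI)
    fix xs assume "xs \<in> chains ?I u v"
    then show "xs \<in> chains P u v"
      by (auto simp: chains_def lt_interval intro: sorted_wrt_mono_rel[of _ "lt ?I" "lt P"])
  next
    fix xs assume xs: "xs \<in> chains P u v"
    then have sub: "set xs \<subseteq> elems ?I"
      using chains_between[OF P xs] by (auto simp: chains_def)
    have "sorted_wrt (lt P) xs"
      using xs by (simp add: chains_def)
    then have "sorted_wrt (lt ?I) xs"
      by (rule sorted_wrt_mono_rel[rotated])
        (use sub in \<open>auto simp: lt_interval simp del: interval_simps\<close>)
    with sub show "xs \<in> chains ?I u v"
      using xs by (simp add: chains_def)
  qed
  then show ?thesis
    using bounding_chains_eq[OF quasi_graded_interval[OF P] l g] by simp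
next
  case False
  have "elems (interval P u v) = {}"
    using False transD[OF quasi_gradedD(2)[OF P], of u _ v] by fastforce
  then have "bounding_chains (interval P u v) = {}"
    by (auto simp: bounding_chains_def is_least_def simp del: interval_simps)
  moreover have "chains P u v = {}"
    using False chains_lt[OF P] by (auto simp: lt_def)
  ultimately show ?thesis by simp
qed

lemma ab_index_interval:
  assumes "quasi_graded P" and "u \<in> elems P" and "v \<in> elems P"
  shows "\<Psi> (interval P u v) = sum (weight P) (chains P u v)"
  by (simp add: ab_index_def bounding_chains_interval[OF assms] weight_interval
      flip: weight_def)

lemma finite_chains:
  assumes "quasi_graded P" and "u \<in> elems P" and "v \<in> elems P"
  shows "finite (chains P u v)"
  using finite_bounding_chains[OF quasi_graded_interval[OF assms(1)]]
  by (metis bounding_chains_interval[OF assms])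

lemma ab_index_eq_interval:
  assumes P: "quasi_graded P" and l: "is_least P u" and g: "is_greatest P v"
  shows "\<Psi> P = \<Psi> (interval P u v)"
proof -
  have "u \<in> elems P" "v \<in> elems P"
    using l g by (simp_all add: is_least_def is_greatest_def)
  then have "\<Psi> (interval P u v) = sum (weight P) (chains P u v)"
    by (rule ab_index_interval[OF P])
  then show ?thesis
    by (simp add: ab_index_def bounding_chains_eq[OF assms] flip: weight_def)
qed

lemma ab_index_interval_not_lt:
  assumes "quasi_graded P" and "u \<in> elems P" and "v \<in> elems P" and "\<not> lt P u v"
  shows "\<Psi> (interval P u v) = 0"
proof -
  have "chains P u v = {}"
    using chains_lt[OF assms(1)] assms(4) by blast
  then show ?thesis
    by (simp add: ab_index_interval[OF assms(1-3)])
qed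

section \<open>The recursion on the first step of a chain\<close>

lemma chains_decomp:
  assumes P: "quasi_graded P" and "u \<in> elems P" and "v \<in> elems P"
  shows "chains P u v = (if lt P u v then {[u, v]} else {}) \<union>
    (\<Union>t\<in>{t \<in> elems P. lt P u t}. (#) u ` chains P t v)"
    (is "_ = ?A \<union> ?B")
proof (intro set_eqI iffI)
  fix xs assume xs: "xs \<in> chains P u v"
  then obtain t ys where ys: "xs = u # t # ys"
    by (cases xs; cases "tl xs") (auto simp: chains_def)
  show "xs \<in> ?A \<union> ?B"
  proof (cases ys)
    case Nil
    then show ?thesis using xs ys by (auto simp: chains_def)
  next
    case (Cons s zs)
    then have "t # ys \<in> chains P t v" "lt P u t" "t \<in> elems P"
      using xs ys by (auto simp: chains_def)
    then show ?thesis using ys by blast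
  qed
next
  fix xs assume "xs \<in> ?A \<union> ?B"
  then consider "lt P u v" "xs = [u, v]"
    | t ys where "t \<in> elems P" "lt P u t" "ys \<in> chains P t v" "xs = u # ys"
    by (auto split: if_splits)
  then show "xs \<in> chains P u v"
  proof cases
    case 1
    then show ?thesis using assms by (simp add: chains_def)
  next
    case 2
    then obtain zs where "ys = t # zs"
      by (cases ys) (auto simp: chains_def)
    then show ?thesis
      using 2 assms(2) transpD[OF transp_lt[OF P]] by (auto simp: chains_def)
  qed
qed

text \<open>Summands with \<open>t\<close> not above \<open>u\<close> vanish through
  \<open>step\<close>, those with \<open>t\<close> not strictly below \<open>v\<close> because there
  is no chain from \<open>t\<close> to \<open>v\<close>.\<close>

lemma ab_index_interval_rec:
  assumes P: "quasi_graded P" and u: "u \<in> elems P" and v: "v \<in> elems P"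
  shows "\<Psi> (interval P u v) =
    step P u v + (\<Sum>t\<in>elems P. step P u t * \<^bold>b * \<Psi> (interval P t v))"
proof -
  let ?T = "{t \<in> elems P. lt P u t}"
  let ?A = "if lt P u v then {[u, v]} else {}"
  let ?B = "\<Union>t\<in>?T. (#) u ` chains P t v"
  have fin: "finite (elems P)"
    using quasi_gradedD(1)[OF P] .
  \<comment> \<open>Chains in \<open>?B\<close> have at least three entries, so they differ from
    \<open>[u, v]\<close>.\<close>
  have "sum (weight P) (chains P u v) = sum (weight P) ?A + sum (weight P) ?B"
    unfolding chains_decomp[OF assms]
    by (intro sum.union_disjoint) (use fin finite_chains[OF P _ v] in \<open>auto simp: chains_def\<close>)
  also have "sum (weight P) ?A = step P u v"
    using weight_pair[of P u v] quasi_gradedD(5)[OF P, of u v] step_not_lt[OF assms] by auto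
  \<comment> \<open>The union is disjoint because \<open>t\<close> is recovered as the second entry
    of the chain.\<close>
  also have "sum (weight P) ?B = (\<Sum>t\<in>?T. sum (weight P) ((#) u ` chains P t v))"
    by (intro sum.UNION_disjoint) (use fin finite_chains[OF P _ v] in \<open>auto simp: chains_def\<close>)
  also have "\<dots> = (\<Sum>t\<in>?T. step P u t * \<^bold>b * \<Psi> (interval P t v))"
  proof (rule sum.cong[OF refl])
    fix t assume t: "t \<in> ?T"
    have "weight P (u # xs) = step P u t * \<^bold>b * weight P xs" if "xs \<in> chains P t v" for xs
      using weight_Cons[of P u xs] that t quasi_gradedD(5)[OF P, of u t] by (simp add: chains_def)
    then show "sum (weight P) ((#) u ` chains P t v) = step P u t * \<^bold>b * \<Psi> (interval P t v)"
      using t by (simp add: sum.reindex ab_index_interval[OF P _ v] sum_distrib_left)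
  qed
  also have "\<dots> = (\<Sum>t\<in>elems P. step P u t * \<^bold>b * \<Psi> (interval P t v))"
    by (rule sum.mono_neutral_left) (use fin step_not_lt[OF P u] in auto)
  finally show ?thesis
    by (simp add: ab_index_interval[OF assms])
qed

text \<open>The recursion expresses a value at \<open>u\<close> through values at elements of larger
  rank. Ranks on a finite set are bounded, so the distance to the largest one serves as
  measure.\<close>

lemma rank_descending_induct [consumes 2, case_names descend]:
  fixes r :: "'a \<Rightarrow> nat"
  assumes "finite S" and "u \<in> S"
    and descend: "\<And>u. u \<in> S \<Longrightarrow> (\<And>t. t \<in> S \<Longrightarrow> r u < r t \<Longrightarrow> \<Phi> t) \<Longrightarrow> \<Phi> u"
  shows "\<Phi> u"
  using assms(2)
proof (induction "Max (r ` S) - r u" arbitrary: u rule: less_induct)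
  case less
  show ?case
  proof (rule descend[OF less.prems])
    fix t assume t: "t \<in> S" "r u < r t"
    then have "r t \<le> Max (r ` S)"
      using assms(1) by simp
    then show "\<Phi> t"
      using t by (intro less.hyps) auto
  qed
qed

section \<open>Zippers, the zipped poset and notation for both posets\<close>

lemma covers_if_rank_Suc:
  assumes P: "quasi_graded P" and "lt P u v" and "rank P v = rank P u + 1"
  shows "covers P v u"
  unfolding covers_def
proof (intro conjI notI, fact)
  assume "\<exists>t. lt P u t \<and> lt P t v"
  then obtain t where "lt P u t" "lt P t v" by blast
  then show False
    using quasi_gradedD(5)[OF P, of u t] quasi_gradedD(5)[OF P, of t v] assms(3) by simp
qed

lemma zipped_simps:
  "elems (zipped P x y z w) = insert w (elems P - {x, y, z})"
  "rank (zipped P x y z w) = (rank P)(w := rank P x)"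
  "zeta (zipped P x y z w) = (\<lambda>u v.
         if u = w \<and> v = w then 1
         else if u = w then zeta P x v
         else if v = w then zeta P u x + zeta P u y - zeta P u z
         else zeta P u v)"
  by (simp_all add: zipped_def Let_def)

text \<open>Only generating pairs of the closure are listed; they suffice to see that the least and
  greatest elements of \<open>P\<close> keep their roles after zipping.\<close>

lemma zipped_ordI:
  assumes "u \<in> elems P - {x, y, z}"
  shows "v \<in> elems P - {x, y, z} \<Longrightarrow> (u, v) \<in> ord P \<Longrightarrow> (u, v) \<in> ord (zipped P x y z w)"
    and "lt P u x \<Longrightarrow> (u, w) \<in> ord (zipped P x y z w)"
    and "lt P x u \<Longrightarrow> (w, u) \<in> ord (zipped P x y z w)"
  unfolding zipped_def Let_def qg_poset.simps by (rule r_into_trancl, use assms in blast)+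

lemma d_poly_eq: "\<^bold>b * \<^bold>c + (\<^bold>a - \<^bold>b) * \<^bold>b = \<^bold>d"
  by (simp add: c_poly_def d_poly_def algebra_simps)

locale zipping =
  fixes P :: "'p qg_poset" and x y z w :: 'p
  assumes P: "quasi_graded P" and zip: "zipper P x y z" and w: "w \<notin> elems P"
begin

definition Q where "Q = zipped P x y z w"
definition S where "S = elems P - {x, y, z}"
definition K where "K = step P"
definition L where "L = step Q"
definition F where "F u v = \<Psi> (interval P u v)"
definition G where "G u v = \<Psi> (interval Q u v)"

lemma Q: "quasi_graded Q"
  unfolding Q_def by (rule quasi_graded_zipped[OF P zip w])

lemma xyz: "x \<in> elems P" "y \<in> elems P" "z \<in> elems P" "x \<noteq> y" "x \<noteq> z" "y \<noteq> z"
  and rank_y: "rank P y = rank P x" and rank_x: "rank P x = rank P z + 1"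
  and covers_z: "{t \<in> elems P. covers P t z} = {x, y}"
  and zeta_zip: "\<And>v. v \<in> elems P \<Longrightarrow> lt P z v \<Longrightarrow> rank P v > rank P x \<Longrightarrow>
      zeta P x v = zeta P y v \<and> zeta P y v = zeta P z v"
  and zeta_zx: "zeta P z x = 1" and zeta_zy: "zeta P z y = 1"
  using zip by (auto simp: zipper_def)

lemma lt_zx: "lt P z x" and lt_zy: "lt P z y"
  using covers_z by (auto simp: covers_def)

lemma w_notin_S: "w \<notin> S" and finite_S: "finite S" and S_subset: "S \<subseteq> elems P"
  using w quasi_gradedD(1)[OF P] by (auto simp: S_def)

lemma elems_P: "elems P = insert x (insert y (insert z S))" and elems_Q: "elems Q = insert w S"
  using xyz by (auto simp: S_def Q_def zipped_simps)

lemma xyz_notin_S: "x \<notin> S" "y \<notin> S" "z \<notin> S"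
  by (auto simp: S_def)

lemma rank_Q: "rank Q w = rank P x" "u \<in> S \<Longrightarrow> rank Q u = rank P u"
  using w_notin_S by (auto simp: Q_def zipped_simps)

section \<open>Step kernels before and after zipping\<close>

lemma K_zeta:
  assumes that: "u \<in> elems P" "v \<in> elems P" "\<not> lt P u v"
  shows "K u v = 0"
  using step_not_lt[OF P that] by (simp add: K_def)

lemma K_rank:
  assumes that: "rank P v \<le> rank P u"
  shows "K u v = 0"
  using that by (simp add: K_def)

text \<open>Extends the zipper condition to \<open>v\<close> not above \<open>z\<close>: such
  \<open>v\<close> are not above \<open>x\<close> or \<open>y\<close> either, and all three values
  are 0.\<close>

lemma zeta_xyz:
  assumes v: "v \<in> elems P" "rank P v > rank P x"
  shows "zeta P x v = zeta P z v \<and> zeta P y v = zeta P z v"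
proof (cases "(z, v) \<in> ord P")
  case True
  moreover have "z \<noteq> v"
    using v rank_x by auto
  ultimately show ?thesis
    using zeta_zip[OF v(1) _ v(2)] by (simp add: lt_def)
next
  case False
  then have "(x, v) \<notin> ord P" "(y, v) \<notin> ord P"
    using lt_zx lt_zy transD[OF quasi_gradedD(2)[OF P]] by (auto simp: lt_def)
  then show ?thesis
    using False quasi_gradedD(6)[OF P] v xyz by metis
qed

lemma K_y_eq:
  assumes that: "v \<in> elems P"
  shows "K y v = K x v"
  using zeta_xyz[OF that] rank_y by (simp add: K_def step_def)

text \<open>Since \<open>z\<close> lies one rank below \<open>x\<close>, its exponent is larger by
  one. At ranks up to that of \<open>x\<close> both sides vanish: an element of \<open>S\<close>
  above \<open>z\<close> there would cover \<open>z\<close>, but only \<open>x\<close> and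
  \<open>y\<close> do.\<close>

lemma K_z_eq:
  assumes v: "v \<in> S"
  shows "K z v = (\<^bold>a - \<^bold>b) * K x v"
proof (cases "rank P v > rank P x")
  case True
  then obtain n where "rank P v = rank P x + Suc n"
    using less_imp_Suc_add by fastforce
  moreover have "zeta P z v = zeta P x v"
    using zeta_xyz[of v] True v S_subset by auto
  ultimately show ?thesis
    using rank_x by (simp add: K_def step_def) (metis ab_const_commute mult.assoc)
next
  case False
  have "\<not> lt P z v"
  proof
    assume lt: "lt P z v"
    then have "rank P v = rank P z + 1"
      using quasi_gradedD(5)[OF P lt] False rank_x by simp
    then show False
      using covers_if_rank_Suc[OF P lt] covers_z v by (auto simp: S_def)
  qed
  then show ?thesis
    using False K_zeta[of z v] K_rank[of v x] xyz v S_subset by auto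
qed

lemma K_z_covers:
  "K z x = 1" "K z y = 1"
  using rank_x rank_y zeta_zx zeta_zy by (simp_all add: K_def step_def)

lemma L_S:
  assumes that: "u \<in> S" "v \<in> S"
  shows "L u v = K u v"
  using that w_notin_S rank_Q by (auto simp: L_def K_def step_def) (auto simp: Q_def zipped_simps)

lemma L_from_w:
  assumes that: "v \<in> S"
  shows "L w v = K x v"
  using that w_notin_S rank_Q by (auto simp: L_def K_def step_def) (auto simp: Q_def zipped_simps)

lemma L_ww:
  "L w w = 0"
  by (simp add: L_def)

text \<open>The exponent towards \<open>w\<close> is that towards \<open>x\<close> and
  \<open>y\<close>, one more than towards \<open>z\<close>; the factor \<open>a - b\<close> makes up
  for the difference.\<close>

lemma L_to_w:
  assumes u: "u \<in> S"
  shows "L u w = K u x + K u y - K u z * (\<^bold>a - \<^bold>b)"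
proof -
  have zw: "zeta Q u w = zeta P u x + zeta P u y - zeta P u z"
    using u w_notin_S by (auto simp: Q_def zipped_simps)
  consider "rank P u < rank P z" | "rank P u = rank P z" | "rank P u > rank P z"
    by linarith
  then show ?thesis
  proof cases
    case 1
    then obtain n where "rank P z = rank P u + Suc n"
      using less_imp_Suc_add by fastforce
    then show ?thesis
      using u rank_x rank_y rank_Q zw
      by (simp add: L_def K_def step_def ab_const_add ab_const_diff power_commutes
          mult.assoc distrib_right left_diff_distrib)
  next
    \<comment> \<open>Here the exponent towards \<open>w\<close> is 0 while \<open>K u z\<close> is
      cut off, so the formula needs \<open>zeta P u z = 0\<close>; this holds because distinct
      elements of equal rank are incomparable.\<close>
    case 2
    then have "(u, z) \<notin> ord P"
      using quasi_gradedD(5)[OF P, of u z] u xyz_notin_S by (auto simp: lt_def)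
    then have "zeta P u z = 0"
      using quasi_gradedD(6)[OF P] u S_subset xyz by blast
    then show ?thesis
      using 2 u rank_x rank_y rank_Q zw by (simp add: L_def K_def step_def ab_const_add)
  next
    case 3
    then show ?thesis
      using u rank_x rank_y rank_Q by (simp add: L_def K_def)
  qed
qed

section \<open>The first identity: intervals with upper end in \<open>S\<close>\<close>

lemma F_rec:
  assumes that: "u \<in> elems P" "v \<in> elems P"
  shows "F u v = K u v + K u x * \<^bold>b * F x v + K u y * \<^bold>b * F y v + K u z * \<^bold>b * F z v
    + (\<Sum>t\<in>S. K u t * \<^bold>b * F t v)"
  using ab_index_interval_rec[OF P that] xyz xyz_notin_S finite_S
  by (simp add: F_def K_def elems_P add.assoc)

lemma G_rec:
  assumes that: "u \<in> elems Q" "v \<in> elems Q"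
  shows "G u v = L u v + L u w * \<^bold>b * G w v + (\<Sum>t\<in>S. L u t * \<^bold>b * G t v)"
  using ab_index_interval_rec[OF Q that] w_notin_S finite_S
  by (simp add: G_def L_def elems_Q add.assoc)

lemma F_rank:
  assumes that: "u \<in> elems P" "v \<in> elems P" "rank P v \<le> rank P u"
  shows "F u v = 0"
  using ab_index_interval_not_lt[OF P that(1,2)] quasi_gradedD(5)[OF P, of u v] that(3)
  by (auto simp: F_def)

lemma G_ww:
  "G w w = 0"
  using ab_index_interval_not_lt[OF Q, of w w] by (simp add: G_def elems_Q lt_def)

text \<open>No step from \<open>x\<close> ends in \<open>x\<close>, \<open>y\<close> or
  \<open>z\<close>, whose ranks are not larger, so only \<open>S\<close> contributes.\<close>

lemma F_x_rec:
  assumes vS: "v \<in> S"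
  shows "K x v + (\<Sum>t\<in>S. K x t * \<^bold>b * F t v) = F x v"
  using F_rec[of x v] K_rank[of _ x] xyz rank_x rank_y subsetD[OF S_subset vS] by simp

lemma F_y_eq:
  assumes vS: "v \<in> S"
  shows "F y v = F x v"
  using F_rec[of y v] K_rank[of _ y] xyz rank_x rank_y K_y_eq S_subset subsetD[OF S_subset vS]
    F_x_rec[OF vS]
  by (simp add: subset_iff)

lemma F_z_eq:
  assumes vS: "v \<in> S"
  shows "F z v = \<^bold>c * F x v"
proof -
  have "F z v = (\<^bold>a - \<^bold>b) * K x v + \<^bold>b * F x v + \<^bold>b * F x v + (\<Sum>t\<in>S. (\<^bold>a - \<^bold>b) * (K x t * \<^bold>b * F t v))"
    using F_rec[of z v] K_rank[of z z] xyz K_z_covers K_z_eq vS subsetD[OF S_subset vS]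
      F_y_eq[OF vS]
    by (simp add: mult.assoc)
  also have "\<dots> = (\<^bold>a - \<^bold>b) * F x v + \<^bold>b * F x v + \<^bold>b * F x v"
    unfolding F_x_rec[OF vS, symmetric] by (simp add: sum_distrib_left distrib_left add_ac)
  finally show ?thesis
    by (simp add: c_poly_def algebra_simps)
qed

text \<open>From such \<open>u\<close> no step reaches \<open>w\<close> or the zipper, so both
  recursions run inside \<open>S\<close> with equal kernels. Proved first because it determines
  \<open>G w v\<close>, which enters the recursion for the remaining \<open>u\<close>.\<close>

lemma G_eq_F_above_z:
  assumes that: "u \<in> S" and vS: "v \<in> S"
  shows "rank P u > rank P z \<longrightarrow> G u v = F u v"
  using finite_S that(1)
proof (induction u rule: rank_descending_induct[where r = "rank P"])
  case (descend u)
  have "L u t * \<^bold>b * G t v = K u t * \<^bold>b * F t v" if "t \<in> S" "rank P u > rank P z" for t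
    using that descend L_S K_rank[of t u] by (cases "rank P u < rank P t") auto
  then show ?case
    using F_rec[of u v] G_rec[of u v] descend(1) S_subset vS subsetD[OF S_subset vS] elems_Q L_S
      L_to_w K_rank[of _ u] rank_x rank_y
    by auto
qed

lemma G_from_w:
  assumes vS: "v \<in> S"
  shows "G w v = F x v"
proof -
  have "L w t * \<^bold>b * G t v = K x t * \<^bold>b * F t v" if "t \<in> S" for t
    using that L_from_w[of t] G_eq_F_above_z[OF _ vS, of t] K_rank[of t x] rank_x
    by (cases "rank P x < rank P t") auto
  then show ?thesis
    using G_rec[of w v] L_from_w L_ww vS elems_Q F_x_rec[OF vS] by simp
qed

lemma F_to_z_eq_0:
  "F x z = 0" "F y z = 0" "F z z = 0"
  using F_rank xyz rank_x rank_y by simp_all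

lemma F_to_z_rec:
  assumes that: "u \<in> S"
  shows "F u z = K u z + (\<Sum>t\<in>S. K u t * \<^bold>b * F t z)"
  using F_rec[of u z] that S_subset xyz F_to_z_eq_0 by auto

lemma G_eq_F_diff:
  assumes that: "u \<in> S" and vS: "v \<in> S"
  shows "G u v = F u v - F u z * \<^bold>d * F x v"
  using finite_S that(1)
proof (induction u rule: rank_descending_induct[where r = "rank P"])
  case (descend u)
  \<comment> \<open>The induction hypothesis covers \<open>t\<close> of larger rank; for all others
    the kernel is zero.\<close>
  have "L u t * \<^bold>b * G t v = K u t * \<^bold>b * F t v - K u t * \<^bold>b * F t z * (\<^bold>d * F x v)" if "t \<in> S" for t
    using that descend L_S[of u t] K_rank[of t u]
    by (cases "rank P u < rank P t") (auto simp: right_diff_distrib mult.assoc)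
  then have G_eq: "G u v = K u v + (K u x + K u y - K u z * (\<^bold>a - \<^bold>b)) * \<^bold>b * F x v
      + ((\<Sum>t\<in>S. K u t * \<^bold>b * F t v) - (\<Sum>t\<in>S. K u t * \<^bold>b * F t z) * (\<^bold>d * F x v))"
    using G_rec[of u v] descend(1) vS elems_Q L_S L_to_w G_from_w[OF vS]
    by (simp add: sum_subtractf sum_distrib_right)
  have F_eq: "F u v = K u v + K u x * \<^bold>b * F x v + K u y * \<^bold>b * F x v
      + K u z * \<^bold>b * (\<^bold>c * F x v) + (\<Sum>t\<in>S. K u t * \<^bold>b * F t v)"
    using F_rec[of u v] descend(1) S_subset subsetD[OF S_subset vS] F_y_eq[OF vS] F_z_eq[OF vS]
    by (simp add: subset_iff)
  \<comment> \<open>\<open>d\<close> is split so that the part \<open>b c\<close> cancels the steps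
    of \<open>P\<close> through \<open>z\<close>, and \<open>(a - b) b\<close> accounts for the
    correction term in \<open>L u w\<close>.\<close>
  have Fd_eq: "F u z * \<^bold>d * F x v =
      K u z * (\<^bold>b * \<^bold>c + (\<^bold>a - \<^bold>b) * \<^bold>b) * F x v + (\<Sum>t\<in>S. K u t * \<^bold>b * F t z) * (\<^bold>d * F x v)"
    unfolding d_poly_eq by (subst F_to_z_rec[OF descend(1)]) (simp add: distrib_right mult.assoc)
  show ?case
    unfolding G_eq F_eq Fd_eq by (simp add: algebra_simps)
qed

section \<open>The second identity: intervals with upper end \<open>w\<close>\<close>

lemma F_z_covers:
  "F z x = 1" "F z y = 1"
proof -
  have "F z v = 1" if v: "v \<in> {x, y}" for v
  proof -
    have v': "v \<in> elems P" "rank P v = rank P x"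
      using v xyz rank_y by auto
    \<comment> \<open>Only the direct step from \<open>z\<close> to \<open>v\<close> counts: an
      element \<open>t\<close> of rank above \<open>x\<close> cannot reach \<open>v\<close>, and to
      any other \<open>t\<close> in \<open>S\<close> there is no step from \<open>z\<close>.\<close>
    have "K z t * \<^bold>b * F t v = 0" if "t \<in> S" for t
    proof (cases "rank P t > rank P x")
      case True
      then show ?thesis using F_rank[of t v] v' that S_subset by auto
    next
      case False
      then show ?thesis using K_z_eq[OF that] K_rank[of t x] by simp
    qed
    then show ?thesis
      using F_rec[of z v] K_rank[of z z] F_rank[of x v] F_rank[of y v] v v' xyz rank_y K_z_covers
      by auto
  qed
  then show "F z x = 1" "F z y = 1"
    by auto
qed

lemma F_xy_eq_0:
  "F x x = 0" "F y x = 0" "F x y = 0" "F y y = 0"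
  using F_rank xyz rank_y by simp_all

lemma G_to_w:
  assumes that: "u \<in> S"
  shows "G u w = F u x + F u y - F u z * \<^bold>c"
  using finite_S that(1)
proof (induction u rule: rank_descending_induct[where r = "rank P"])
  case (descend u)
  have "L u t * \<^bold>b * G t w =
      K u t * \<^bold>b * F t x + K u t * \<^bold>b * F t y - K u t * \<^bold>b * F t z * \<^bold>c" if "t \<in> S" for t
    using that descend L_S[of u t] K_rank[of t u]
    by (cases "rank P u < rank P t") (auto simp: distrib_left right_diff_distrib mult.assoc)
  then have "G u w = K u x + K u y - K u z * (\<^bold>a - \<^bold>b) + ((\<Sum>t\<in>S. K u t * \<^bold>b * F t x)
      + (\<Sum>t\<in>S. K u t * \<^bold>b * F t y) - (\<Sum>t\<in>S. K u t * \<^bold>b * F t z) * \<^bold>c)"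
    using G_rec[of u w] descend(1) elems_Q L_to_w G_ww
    by (simp add: sum_subtractf sum.distrib sum_distrib_right)
  \<comment> \<open>Of the zipper elements only \<open>z\<close> contributes as first step, with
    \<open>F z x = F z y = 1\<close>; \<open>x\<close> and \<open>y\<close> have equal rank and do
    not reach each other.\<close>
  moreover have "F u x = K u x + K u z * \<^bold>b + (\<Sum>t\<in>S. K u t * \<^bold>b * F t x)"
    "F u y = K u y + K u z * \<^bold>b + (\<Sum>t\<in>S. K u t * \<^bold>b * F t y)"
    using F_rec[of u x] F_rec[of u y] descend(1) S_subset xyz F_z_covers F_xy_eq_0 by auto
  moreover have "F u z * \<^bold>c = K u z * \<^bold>a + K u z * \<^bold>b + (\<Sum>t\<in>S. K u t * \<^bold>b * F t z) * \<^bold>c"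
    by (subst F_to_z_rec[OF descend(1)]) (simp add: distrib_right c_poly_def distrib_left)
  ultimately show ?case
    by (simp add: right_diff_distrib)
qed

end

section \<open>Both ends of \<open>P\<close> survive zipping, and the identities are read
  off\<close>

theorem proposition5p8:
  fixes P :: "'p qg_poset" and p0 p1 x y z w :: 'p
  assumes "quasi_graded P"
    and "is_least P p0" and "is_greatest P p1"
    and "zipper P x y z" and "z \<noteq> p0"
    and "w \<notin> elems P"
  shows "\<Psi> (zipped P x y z w) =
           \<Psi> P - \<Psi> (interval P p0 z) * \<^bold>d * \<Psi> (interval P x p1) \<and>
         \<Psi> (interval (zipped P x y z w) p0 w) =
           \<Psi> (interval P p0 x) + \<Psi> (interval P p0 y) - \<Psi> (interval P p0 z) * \<^bold>c"
proof -
  interpret zipping P x y z w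
    using assms(1,4,6) by unfold_locales
  have p: "p0 \<in> elems P" "p1 \<in> elems P" "\<And>u. u \<in> elems P \<Longrightarrow> (p0, u) \<in> ord P"
    "\<And>u. u \<in> elems P \<Longrightarrow> (u, p1) \<in> ord P"
    using assms(2,3) by (auto simp: is_least_def is_greatest_def)
  \<comment> \<open>This is where \<open>z \<noteq> p0\<close> enters: it puts \<open>p0\<close> at
    smaller rank than the whole zipper, hence into \<open>S\<close>.\<close>
  have "lt P p0 z"
    using p xyz assms(5) by (auto simp: lt_def)
  then have p0z: "rank P p0 < rank P z"
    by (rule quasi_gradedD(5)[OF P])
  have p0S: "p0 \<in> S"
    using p p0z rank_x rank_y by (auto simp: S_def)
  have "u = p1 \<or> rank P u < rank P p1" if "u \<in> elems P" for u
    using p(4)[OF that] quasi_gradedD(5)[OF P, of u p1] by (auto simp: lt_def)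
  \<comment> \<open>At least one of \<open>x\<close> and \<open>y\<close> differs from
    \<open>p1\<close>; as their ranks agree, both have rank below that of \<open>p1\<close>.\<close>
  from this[of x] this[of y] have p1x: "rank P x < rank P p1"
    using xyz rank_y by auto
  then have p1S: "p1 \<in> S"
    using p rank_x rank_y by (auto simp: S_def)
  have p0x: "lt P p0 x" and xp1: "lt P x p1"
    using p xyz p0z p1x rank_x by (auto simp: lt_def)
  note ordI = zipped_ordI[where P = P and x = x and y = y and z = z and w = w, folded S_def Q_def]
  \<comment> \<open>With \<open>p0\<close> least and \<open>p1\<close> greatest in \<open>Q\<close>,
    the ab-index of \<open>Q\<close> is \<open>G p0 p1\<close>. The comparisons with
    \<open>w\<close> come from \<open>p0 < x < p1\<close>.\<close>
  have least: "is_least Q p0"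
    using p0S p(3) S_subset ordI(1,2)[OF p0S] p0x by (auto simp: is_least_def elems_Q)
  have greatest: "is_greatest Q p1"
    using p1S p(4) S_subset ordI(1)[OF _ p1S] ordI(3)[OF p1S] xp1
    by (auto simp: is_greatest_def elems_Q)
  have "\<Psi> Q = \<Psi> P - F p0 z * \<^bold>d * F x p1"
    using G_eq_F_diff[OF p0S p1S] ab_index_eq_interval[OF Q least greatest]
      ab_index_eq_interval[OF assms(1-3)] by (simp add: G_def F_def)
  then show ?thesis
    using G_to_w[OF p0S] by (simp add: F_def G_def Q_def)
qed

end
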